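(* Let $q$ be a positive integer and let $A\subseteq\mathbb{Z}_q$ be a nonempty set with $|A|=\alpha q$. Suppose that the least prime factor of $q$ is greater than $2\alpha^{-1}+3$. Then $$\mathrm{cov}^{\times}(A-A)\le\frac{1}{\alpha}+1.$$ More concretely, $[k_*]^{-1}\cdot(A-A)=\mathbb{Z}_q$ for a certain positive integer $k_*\le\alpha^{-1}+1$.
   Context: $\mathbb{Z}_q=\mathbb{Z}/q\mathbb{Z}$. $A-A=\{a-a': a,a'\in A\}$. For $S\subseteq\mathbb{Z}_q$, the multiplicative covering number is $\mathrm{cov}^{\times}(S)=\min\{|X|: X\subseteq\mathbb{Z}_q,\ XS=\mathbb{Z}_q\}$, where $XS=\{xs: x\in X,s\in S\}$. $[k]=\{1,2,\dots,k\}$, and $[k]^{-1}\cdot S=\{j^{-1}s: j\in[k],\ s\in S\}$, where $j^{-1}$ is the inverse of $j$ in $\mathbb{Z}_q$ (part of the assertion is that $1,\dots,k_*$ are invertible modulo $q$). *)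

theory Defs
  imports
    "HOL-Algebra.IntRing"
    "HOL-Algebra.Coset"
    "HOL-Library.Extended_Real"
begin

definition difference_set :: "('a, 'm) ring_scheme \<Rightarrow> 'a set \<Rightarrow> 'a set"
  where "difference_set R A = {a \<ominus>\<^bsub>R\<^esub> a' | a a'. a \<in> A \<and> a' \<in> A}"

(* Extended naturals are used so that the minimum is infinite, rather than an unspecified
   number, for a set none of whose finite dilate families covers R. The infimum of a nonempty
   set of extended naturals is attained, so otherwise this is a genuine minimum. *)
definition mult_cov :: "('a, 'm) ring_scheme \<Rightarrow> 'a set \<Rightarrow> enat"
  where "mult_cov R S =
    (INF X \<in> {X. X \<subseteq> carrier R \<and> finite X \<and> X <#>\<^bsub>R\<^esub> S = carrier R}. enat (card X))"

definition nat_in_ring :: "('a, 'm) ring_scheme \<Rightarrow> nat \<Rightarrow> 'a"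
  where "nat_in_ring R j = [j] \<cdot>\<^bsub>R\<^esub> \<one>\<^bsub>R\<^esub>"

(* Meaningful only when 1, ..., k are units of R: the ring inverse m_inv is unspecified
   elsewhere. *)
definition interval_inverses :: "('a, 'm) ring_scheme \<Rightarrow> nat \<Rightarrow> 'a set"
  where "interval_inverses R k = {inv\<^bsub>R\<^esub> (nat_in_ring R j) | j. j \<in> {1..k}}"

end

theory Submission
  imports Defs "HOL-Computational_Algebra.Primes"
begin

text \<open>For \<open>k = \<lfloor>1/\<alpha>\<rfloor>\<close> and any \<open>x\<close>, the \<open>k + 1\<close> translates \<open>A, A + x, \<dots>, A + k x\<close> have total size
  greater than \<open>q\<close>, so two of them meet. Hence \<open>j x \<in> A - A\<close> for some \<open>j \<in> [k]\<close>, and \<open>j\<close> is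
  invertible because \<open>j \<le> 1/\<alpha>\<close> is smaller than every prime factor of \<open>q\<close>.\<close>

lemma (in ring) multiple_in_difference_set:
  assumes fin: "finite (carrier R)" and A: "A \<subseteq> carrier R"
    and card: "card (carrier R) < Suc k * card A" and x: "x \<in> carrier R"
  shows "\<exists>j\<in>{1..k}. [j] \<cdot> x \<in> difference_set R A"
proof -
  \<comment> \<open>A value \<open>f (a, i)\<close> is the point of the translate of
    \<open>A\<close> by \<open>[i] \<cdot> x\<close> that comes from \<open>a\<close>. Since
    \<open>{..k}\<close> includes 0, there are \<open>Suc k\<close> translates, matching the factor
    in the size hypothesis.\<close>
  define f where "f = (\<lambda>(a, i::nat). a \<oplus> [i] \<cdot> x)"
  have "f ` (A \<times> {..k}) \<subseteq> carrier R"
    using A x by (auto simp: f_def)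
  then have "card (f ` (A \<times> {..k})) \<le> card (carrier R)"
    using fin card_mono by blast
  with card have "\<not> inj_on f (A \<times> {..k})"
    by (intro pigeonhole) (simp add: card_cartesian_product mult.commute)
  then obtain a i b j where ab: "a \<in> A" "b \<in> A" and ij: "i \<le> k" "j \<le> k"
    and ne: "(a, i) \<noteq> (b, j)" and eq: "a \<oplus> [i] \<cdot> x = b \<oplus> [j] \<cdot> x"
    by (fastforce simp: inj_on_def f_def)
  \<comment> \<open>Stated for arbitrary \<open>a\<close>, \<open>b\<close>, \<open>i\<close>,
    \<open>j\<close> because the collision does not say which index is larger; it is used a second
    time with the two pairs exchanged. Cancelling \<open>[i] \<cdot> x\<close> leaves
    \<open>[j - i] \<cdot> x\<close> as a difference of elements of \<open>A\<close>.\<close>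
  have witness: "\<exists>l\<in>{1..k}. [l] \<cdot> x \<in> difference_set R A"
    if "a \<in> A" "b \<in> A" "i < j" "j \<le> k" "a \<oplus> [i] \<cdot> x = b \<oplus> [j] \<cdot> x" for a b i j
  proof -
    have c: "a \<in> carrier R" "b \<in> carrier R" using that A by auto
    have "[j] \<cdot> x = ([(j - i)] \<cdot> x) \<oplus> ([i] \<cdot> x)"
      using add.nat_pow_mult[OF x, of "j - i" i] \<open>i < j\<close> by simp
    then have "b \<oplus> ([j] \<cdot> x) = (b \<oplus> ([(j - i)] \<cdot> x)) \<oplus> ([i] \<cdot> x)"
      using c x by (simp add: a_assoc)
    with that(5) have "a = b \<oplus> ([(j - i)] \<cdot> x)"
      using c x by (metis a_closed add.nat_pow_closed add.right_cancel)
    also have "\<dots> = ([(j - i)] \<cdot> x) \<oplus> b"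
      using c x by (intro a_comm) simp_all
    finally have "[(j - i)] \<cdot> x = a \<ominus> b"
      using c x by (simp add: minus_eq a_assoc r_neg)
    then show ?thesis
      using that unfolding difference_set_def
      by (intro bexI[of _ "j - i"]) auto
  qed
  \<comment> \<open>Equal indices would cancel to \<open>a = b\<close>, against the distinctness of
    the two pairs.\<close>
  have "i \<noteq> j"
    using ne eq ab A x by (metis add.nat_pow_closed add.right_cancel subsetD)
  then show ?thesis
    using witness[of a b i j] witness[of b a j i] ab ij eq by (auto simp: neq_iff)
qed

lemma (in ring) difference_set_closed: "A \<subseteq> carrier R \<Longrightarrow> difference_set R A \<subseteq> carrier R"
  by (auto simp: difference_set_def)

text \<open>Once \<open>[j] \<cdot> x\<close> is a difference, multiplying on the left by the
  inverse of the ring element \<open>j\<close> recovers \<open>x\<close>. This step works in any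
  finite ring where 1, ..., \<open>k\<close> are units.\<close>

lemma (in ring) interval_inverses_mult_difference_set:
  assumes fin: "finite (carrier R)" and A: "A \<subseteq> carrier R"
    and card: "card (carrier R) < Suc k * card A"
    and units: "\<forall>j\<in>{1..k}. nat_in_ring R j \<in> Units R"
  shows "interval_inverses R k <#> difference_set R A = carrier R"
proof
  show "interval_inverses R k <#> difference_set R A \<subseteq> carrier R"
    using units difference_set_closed[OF A]
    by (auto simp: interval_inverses_def set_mult_def)
  show "carrier R \<subseteq> interval_inverses R k <#> difference_set R A"
  proof
    fix x assume x: "x \<in> carrier R"
    obtain j where j: "j \<in> {1..k}" and d: "[j] \<cdot> x \<in> difference_set R A"
      using multiple_in_difference_set[OF fin A card x] by blast
    have u: "nat_in_ring R j \<in> Units R" using units j by blast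
    have "[j] \<cdot> x = nat_in_ring R j \<otimes> x"
      using add_pow_ldistr[OF one_closed x, of j] x by (simp add: nat_in_ring_def)
    then have "x = inv (nat_in_ring R j) \<otimes> ([j] \<cdot> x)"
      using u x by (simp add: m_assoc[symmetric] Units_closed)
    with j d show "x \<in> interval_inverses R k <#> difference_set R A"
      unfolding set_mult_def interval_inverses_def by blast
  qed
qed

lemma card_interval_inverses_le: "card (interval_inverses R k) \<le> k"
  and finite_interval_inverses: "finite (interval_inverses R k)"
proof -
  have eq: "interval_inverses R k = (\<lambda>j. inv\<^bsub>R\<^esub> (nat_in_ring R j)) ` {1..k}"
    by (auto simp: interval_inverses_def)
  show "card (interval_inverses R k) \<le> k"
    unfolding eq using card_image_le[of "{1..k}"] by fastforce
  show "finite (interval_inverses R k)"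
    unfolding eq by simp
qed

lemma mult_cov_le_card:
  "\<lbrakk>X \<subseteq> carrier R; finite X; X <#>\<^bsub>R\<^esub> S = carrier R\<rbrakk> \<Longrightarrow> mult_cov R S \<le> enat (card X)"
  unfolding mult_cov_def by (rule INF_lower) simp

text \<open>\<open>ZMod m\<close> is the coset map onto the quotient by the ideal generated by
  \<open>m\<close>; this lets integer identities pass to residues.\<close>

lemma ZMod_ring_hom: "ZMod m \<in> ring_hom \<Z> (ZFact m)"
proof -
  interpret ideal "Idl\<^bsub>\<Z>\<^esub> {m}" \<Z>
    by (rule int.genideal_ideal) simp
  have "ZMod m = (+>\<^bsub>\<Z>\<^esub>) (Idl\<^bsub>\<Z>\<^esub> {m})"
    by (simp add: ZMod_def fun_eq_iff)
  then show ?thesis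
    using rcos_ring_hom by (simp add: ZFact_def)
qed

lemma carrier_ZFact: "carrier (ZFact m) = range (ZMod m)"
  by (auto simp: ZFact_def FactRing_def A_RCOSETS_defs ZMod_def a_r_coset_def r_coset_def)

text \<open>Listing representatives gives both finiteness of the ring and the bound \<open>q\<close>
  on its size, the form in which the pigeonhole count uses it.\<close>

lemma carrier_ZFact_eq_image:
  assumes "q > 0"
  shows "carrier (ZFact (int q)) = ZMod (int q) ` {0..<int q}"
proof -
  have "ZMod (int q) a \<in> ZMod (int q) ` {0..<int q}" for a
    using assms by (subst ZMod_mod) auto
  then show ?thesis
    by (auto simp: carrier_ZFact)
qed

lemma nat_in_ring_ZFact: "nat_in_ring (ZFact m) j = ZMod m (int j)"
proof -
  interpret Z: cring "ZFact m" by (rule ZFact_is_cring)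
  interpret ring_hom_ring \<Z> "ZFact m" "ZMod m"
    by (intro ring_hom_ringI2 ZMod_ring_hom int.ring_axioms Z.ring_axioms)
  show ?thesis
  proof (induction j)
    case 0
    then show ?case using hom_zero by (simp add: nat_in_ring_def)
  next
    case (Suc j)
    have "nat_in_ring (ZFact m) (Suc j) = ZMod m (int j) \<oplus>\<^bsub>ZFact m\<^esub> ZMod m 1"
      using Suc hom_one by (simp add: nat_in_ring_def)
    also have "\<dots> = ZMod m (int j + 1)"
      using hom_add[of "int j" 1] by simp
    finally show ?case by (simp add: add.commute)
  qed
qed

text \<open>A Bezout identity for \<open>j\<close> and \<open>m\<close>, reduced modulo
  \<open>m\<close>, exhibits the inverse.\<close>

lemma nat_in_ring_ZFact_Units:
  assumes "coprime (int j) m"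
  shows "nat_in_ring (ZFact m) j \<in> Units (ZFact m)"
proof -
  interpret Z: cring "ZFact m" by (rule ZFact_is_cring)
  interpret ring_hom_ring \<Z> "ZFact m" "ZMod m"
    by (intro ring_hom_ringI2 ZMod_ring_hom int.ring_axioms Z.ring_axioms)
  obtain u v where "u * int j + v * m = 1"
    using bezout_int[of "int j" m] assms by auto
  then have "(u * int j) mod m = 1 mod m"
    by (metis mod_mult_self1)
  then have "ZMod m (u * int j) = ZMod m 1"
    by (simp only: ZMod_eq_mod)
  then have "ZMod m u \<otimes>\<^bsub>ZFact m\<^esub> ZMod m (int j) = \<one>\<^bsub>ZFact m\<^esub>"
    using hom_mult[of u "int j"] hom_one by simp
  then show ?thesis
    unfolding nat_in_ring_ZFact
    using Z.m_comm[of "ZMod m u" "ZMod m (int j)"] by (auto simp: Units_def carrier_ZFact)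
qed

text \<open>A common prime factor would be at most \<open>j\<close>, yet at least the least prime
  factor of \<open>q\<close>. The case \<open>q = 1\<close> is separate because \<open>Min\<close>
  is then taken over the empty set.\<close>

lemma coprime_if_less_least_prime_factor:
  fixes j q :: nat
  assumes "j > 0" "q > 0" "q = 1 \<or> j < Min (prime_factors q)"
  shows "coprime j q"
proof (rule ccontr)
  assume "\<not> coprime j q"
  then obtain p where p: "prime p" "p dvd j" "p dvd q"
    by (metis prime_factor_nat coprime_iff_gcd_eq_1 gcd_greatest_iff)
  then have "p \<in> prime_factors q" "q \<noteq> 1"
    using \<open>q > 0\<close> by (auto simp: prime_factors_dvd)
  then have "j < p"
    using assms(3) by (auto dest: Min_le[rotated])
  then show False
    using p(2) \<open>j > 0\<close> by (auto dest: dvd_imp_le)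
qed

theorem theorem16:
  fixes q :: nat and A :: "int set set" and \<alpha> :: real
  assumes "q > 0"
    and "A \<subseteq> carrier (ZFact (int q))"
    and "A \<noteq> {}"
    and "real (card A) = \<alpha> * real q"
    and "q = 1 \<or> real (Min (prime_factors q)) > 2 / \<alpha> + 3"
  shows "ereal_of_enat (mult_cov (ZFact (int q)) (difference_set (ZFact (int q)) A))
           \<le> ereal (1 / \<alpha> + 1)
    \<and> (\<exists>k::nat. k > 0 \<and> real k \<le> 1 / \<alpha> + 1
        \<and> (\<forall>j\<in>{1..k}. nat_in_ring (ZFact (int q)) j \<in> Units (ZFact (int q)))
        \<and> interval_inverses (ZFact (int q)) k <#>\<^bsub>ZFact (int q)\<^esub> difference_set (ZFact (int q)) A
            = carrier (ZFact (int q)))"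
proof -
  let ?R = "ZFact (int q)"
  interpret R: cring ?R by (rule ZFact_is_cring)
  have fin: "finite (carrier ?R)" and card_le: "card (carrier ?R) \<le> q"
    using card_image_le[of "{0..<int q}" "ZMod (int q)"] \<open>q > 0\<close>
    by (simp_all add: carrier_ZFact_eq_image)
  have "card A > 0"
    using assms fin by (simp add: card_gt_0_iff finite_subset)
  then have \<alpha>: "\<alpha> > 0"
    using assms(1,4) by (metis of_nat_0_less_iff zero_less_mult_pos2)
  have "card A \<le> q"
    using card_mono[OF fin assms(2)] card_le by simp
  \<comment> \<open>This makes the floor of \<open>1 / \<alpha>\<close> at least 1, so that
    \<open>k\<close> is positive.\<close>
  then have "\<alpha> \<le> 1"
    using assms(1,4) by (simp flip: of_nat_le_iff[where 'a = real])
  define k where "k = nat \<lfloor>1 / \<alpha>\<rfloor>"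
  have k: "real k \<le> 1 / \<alpha>" "1 / \<alpha> < real k + 1"
    using \<alpha> by (simp_all add: k_def)
  have "k > 0"
    using \<alpha> \<open>\<alpha> \<le> 1\<close> by (simp add: k_def)
  have "1 < (real k + 1) * \<alpha>"
    using k(2) \<alpha> by (simp add: field_simps)
  then have "real q < (real k + 1) * \<alpha> * real q"
    using \<open>q > 0\<close> by simp
  also have "\<dots> = real (Suc k * card A)"
    using assms(4) by (simp add: algebra_simps)
  finally have card: "card (carrier ?R) < Suc k * card A"
    using card_le by linarith
  \<comment> \<open>Chains \<open>k \<le> 1 / \<alpha> \<le> 2 / \<alpha>\<close>, placing
    \<open>k\<close> below every prime factor of \<open>q\<close>.\<close>
  have k_less: "real k < 2 / \<alpha> + 3"
    using k(1) divide_right_mono[of 1 2 \<alpha>] \<alpha> by simp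
  have "q = 1 \<or> k < Min (prime_factors q)"
    using assms(5) k_less by linarith
  then have units: "\<forall>j\<in>{1..k}. nat_in_ring ?R j \<in> Units ?R"
    using \<open>q > 0\<close>
    by (auto intro!: nat_in_ring_ZFact_Units coprime_if_less_least_prime_factor)
  have cover: "interval_inverses ?R k <#>\<^bsub>?R\<^esub> difference_set ?R A = carrier ?R"
    by (rule R.interval_inverses_mult_difference_set[OF fin assms(2) card units])
  have "interval_inverses ?R k \<subseteq> carrier ?R"
    using units by (auto simp: interval_inverses_def)
  then have "mult_cov ?R (difference_set ?R A) \<le> enat (card (interval_inverses ?R k))"
    by (intro mult_cov_le_card finite_interval_inverses cover)
  also have "\<dots> \<le> enat k"
    by (simp add: card_interval_inverses_le)
  finally have "ereal_of_enat (mult_cov ?R (difference_set ?R A)) \<le> ereal_of_enat (enat k)"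
    by (simp only: ereal_of_enat_le_iff)
  also have "\<dots> \<le> ereal (1 / \<alpha> + 1)"
    using k(1) by simp
  finally show ?thesis
    using \<open>k > 0\<close> k(1) units cover by (intro conjI exI[of _ k]) auto
qed

end
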